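(* Let $\Gamma$ be a countable discrete group, let $F\subset F'\subset\Gamma$ be finite subsets, and let $A\in\mathcal{N}\Gamma$ be positive, and injective on $\mathbb{C}\Gamma$. Then the endomorphism $$\psi=i_F A_F^{-1}p_F A\, i_{F'}:\mathbb{C}F'\to\mathbb{C}F'$$ is the orthogonal projection of $\mathbb{C}F'$ to $\mathbb{C}F$ with respect to the scalar product $(u,v)_A:=(Au,v)$ on $\mathbb{C}F'$.
   Context: For a discrete group $\Gamma$, $L^2(\Gamma)$ is the Hilbert space of formal series $\sum_\gamma x_\gamma\gamma$ with $\sum_\gamma|x_\gamma|^2<\infty$, with scalar product $(\cdot,\cdot)$ for which the elements of $\Gamma$ form an orthonormal basis; $\mathbb{C}\Gamma\subset L^2(\Gamma)$ is the subspace of finite sums. The von Neumann algebra $\mathcal{N}\Gamma$ is the algebra of bounded operators $A: L^2(\Gamma)\to L^2(\Gamma)$ that commute with left multiplication by every $\gamma\in\Gamma$. "Positive" means positive semidefinite. For a finite subset $F\subset\Gamma$ let $\mathbb{C}F\subset L^2(\Gamma)$ be the span of $F$, $i_F:\mathbb{C}F\hookrightarrow L^2(\Gamma)$ the inclusion and $p_F:L^2(\Gamma)\to\mathbb{C}F$ the orthogonal projection; for $A\in\mathcal{N}\Gamma$ put $A_F=p_F A\, i_F\in\operatorname{End}(\mathbb{C}F)$. If $A$ is positive, and injective on $\mathbb{C}\Gamma$, then $A_F$ is a positive automorphism of $\mathbb{C}F$, and $(u,v)_A=(Au,v)=(u,Av)$ is a positive definite scalar product on $\mathbb{C}\Gamma$.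 In the formula for $\psi$, the image $\mathbb{C}F$ of $A_F^{-1}$ is regarded as a subspace of $\mathbb{C}F'$. *)

theory Defs
  imports "HOL-Analysis.Analysis" "HOL-Algebra.Group"
begin

text \<open>
  A formal series \<open>\<Sum>\<^sub>\<gamma> x\<^sub>\<gamma> \<gamma>\<close> is the function of its coefficients, taken to vanish outside the carrier
  of the group. All subspaces are sets of such functions, so that inclusions between them are
  identities.
\<close>

definition ell2 :: "('g, 'm) monoid_scheme \<Rightarrow> ('g \<Rightarrow> complex) set" where
  "ell2 G = {x. (\<forall>g. g \<notin> carrier G \<longrightarrow> x g = 0) \<and>
                (\<lambda>g. (cmod (x g))\<^sup>2) summable_on carrier G}"

definition ell2_inner ::
    "('g, 'm) monoid_scheme \<Rightarrow> ('g \<Rightarrow> complex) \<Rightarrow> ('g \<Rightarrow> complex) \<Rightarrow> complex" where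
  "ell2_inner G x y = (\<Sum>\<^sub>\<infinity>g\<in>carrier G. x g * cnj (y g))"

definition ell2_norm :: "('g, 'm) monoid_scheme \<Rightarrow> ('g \<Rightarrow> complex) \<Rightarrow> real" where
  "ell2_norm G x = sqrt (Re (ell2_inner G x x))"

definition basis_vec :: "'g \<Rightarrow> 'g \<Rightarrow> complex" where
  "basis_vec \<gamma> = (\<lambda>g. if g = \<gamma> then 1 else 0)"

text \<open>The space \<open>\<complex>F\<close>; only meant for finite \<open>F\<close>.\<close>

definition lin_span :: "'g set \<Rightarrow> ('g \<Rightarrow> complex) set" where
  "lin_span F = {x. \<exists>c. x = (\<lambda>g. \<Sum>\<gamma>\<in>F. c \<gamma> * basis_vec \<gamma> g)}"

definition group_algebra :: "('g, 'm) monoid_scheme \<Rightarrow> ('g \<Rightarrow> complex) set" where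
  "group_algebra G = (\<Union>F\<in>{F. finite F \<and> F \<subseteq> carrier G}. lin_span F)"

definition linear_on ::
    "('g \<Rightarrow> complex) set \<Rightarrow> (('g \<Rightarrow> complex) \<Rightarrow> ('g \<Rightarrow> complex)) \<Rightarrow> bool" where
  "linear_on V T \<longleftrightarrow> (\<forall>x\<in>V. \<forall>y\<in>V. \<forall>a b.
     T (\<lambda>g. a * x g + b * y g) = (\<lambda>g. a * T x g + b * T y g))"

definition bounded_op ::
    "('g, 'm) monoid_scheme \<Rightarrow> (('g \<Rightarrow> complex) \<Rightarrow> ('g \<Rightarrow> complex)) \<Rightarrow> bool" where
  "bounded_op G A \<longleftrightarrow> A ` ell2 G \<subseteq> ell2 G \<and> linear_on (ell2 G) A \<and>
     (\<exists>K. \<forall>x\<in>ell2 G. ell2_norm G (A x) \<le> K * ell2_norm G x)"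

text \<open>\<open>\<gamma> \<cdot> (\<Sum>\<^sub>h x\<^sub>h h) = \<Sum>\<^sub>h x\<^sub>h (\<gamma>h)\<close> has the coefficient \<open>x\<close> at \<open>\<gamma>\<inverse>h\<close> in front of \<open>h\<close>.\<close>

definition left_mult :: "('g, 'm) monoid_scheme \<Rightarrow> 'g \<Rightarrow> ('g \<Rightarrow> complex) \<Rightarrow> ('g \<Rightarrow> complex)" where
  "left_mult G \<gamma> x = (\<lambda>h. if h \<in> carrier G then x (inv\<^bsub>G\<^esub> \<gamma> \<otimes>\<^bsub>G\<^esub> h) else 0)"

text \<open>Operators are total functions of which only the values on \<^term>\<open>ell2 G\<close> matter.\<close>

definition group_vN_algebra ::
    "('g, 'm) monoid_scheme \<Rightarrow> (('g \<Rightarrow> complex) \<Rightarrow> ('g \<Rightarrow> complex)) set" where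
  "group_vN_algebra G = {A. bounded_op G A \<and>
     (\<forall>\<gamma>\<in>carrier G. \<forall>x\<in>ell2 G. A (left_mult G \<gamma> x) = left_mult G \<gamma> (A x))}"

definition positive_op ::
    "('g, 'm) monoid_scheme \<Rightarrow> (('g \<Rightarrow> complex) \<Rightarrow> ('g \<Rightarrow> complex)) \<Rightarrow> bool" where
  "positive_op G A \<longleftrightarrow> (\<forall>x\<in>ell2 G. ell2_inner G (A x) x \<in> \<real> \<and> 0 \<le> Re (ell2_inner G (A x) x))"

definition scalar_product_on ::
    "('g \<Rightarrow> complex) set \<Rightarrow> (('g \<Rightarrow> complex) \<Rightarrow> ('g \<Rightarrow> complex) \<Rightarrow> complex) \<Rightarrow> bool" where
  "scalar_product_on V s \<longleftrightarrow>
     (\<forall>x\<in>V. \<forall>y\<in>V. \<forall>z\<in>V. \<forall>a b. s (\<lambda>g. a * x g + b * y g) z = a * s x z + b * s y z) \<and>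
     (\<forall>x\<in>V. \<forall>y\<in>V. s y x = cnj (s x y)) \<and>
     (\<forall>x\<in>V. x \<noteq> (\<lambda>g. 0) \<longrightarrow> s x x \<in> \<real> \<and> 0 < Re (s x x))"

definition is_orthogonal_projection ::
    "(('g \<Rightarrow> complex) \<Rightarrow> ('g \<Rightarrow> complex) \<Rightarrow> complex) \<Rightarrow> ('g \<Rightarrow> complex) set \<Rightarrow> ('g \<Rightarrow> complex) set \<Rightarrow>
     (('g \<Rightarrow> complex) \<Rightarrow> ('g \<Rightarrow> complex)) \<Rightarrow> bool" where
  "is_orthogonal_projection s V W P \<longleftrightarrow>
     scalar_product_on V s \<and> W \<subseteq> V \<and>
     linear_on V P \<and> P ` V = W \<and> (\<forall>w\<in>W. P w = w) \<and>
     (\<forall>v\<in>V. \<forall>w\<in>W. s (\<lambda>g. v g - P v g) w = 0)"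

definition ell2_proj ::
    "('g, 'm) monoid_scheme \<Rightarrow> 'g set \<Rightarrow> ('g \<Rightarrow> complex) \<Rightarrow> ('g \<Rightarrow> complex)" where
  "ell2_proj G F x =
     (THE y. y \<in> lin_span F \<and> (\<forall>w\<in>lin_span F. ell2_inner G (\<lambda>g. x g - y g) w = 0))"

definition compression ::
    "('g, 'm) monoid_scheme \<Rightarrow> (('g \<Rightarrow> complex) \<Rightarrow> ('g \<Rightarrow> complex)) \<Rightarrow> 'g set \<Rightarrow>
     ('g \<Rightarrow> complex) \<Rightarrow> ('g \<Rightarrow> complex)" where
  "compression G A F u = ell2_proj G F (A u)"

lemma lin_span_eq:
  assumes "finite F"
  shows "lin_span F = {x. \<forall>g. g \<notin> F \<longrightarrow> x g = 0}"
proof -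
  have *: "(\<Sum>\<gamma>\<in>F. c \<gamma> * basis_vec \<gamma> g) = (if g \<in> F then c g else 0)" for c g
  proof -
    have "(\<Sum>\<gamma>\<in>F. c \<gamma> * basis_vec \<gamma> g) = (\<Sum>\<gamma>\<in>F. if g = \<gamma> then c \<gamma> else 0)"
      by (rule sum.cong) (auto simp: basis_vec_def)
    then show ?thesis using assms by simp
  qed
  show ?thesis unfolding lin_span_def * by (auto simp: fun_eq_iff)
qed

lemma ell2_inner_summable:
  assumes "x \<in> ell2 G" "y \<in> ell2 G"
  shows "(\<lambda>g. x g * cnj (y g)) summable_on carrier G"
proof (rule Infinite_Sum.abs_summable_summable, rule Infinite_Sum.abs_summable_on_comparison_test')
  show "(\<lambda>g. (cmod (x g))\<^sup>2 + (cmod (y g))\<^sup>2) summable_on carrier G"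
    using assms by (intro summable_on_add) (auto simp: ell2_def)
  fix g
  have "2 * cmod (x g) * cmod (y g) \<le> (cmod (x g))\<^sup>2 + (cmod (y g))\<^sup>2"
    by (rule sum_squares_bound)
  moreover have "0 \<le> cmod (x g) * cmod (y g)" by simp
  ultimately show "norm (x g * cnj (y g)) \<le> (cmod (x g))\<^sup>2 + (cmod (y g))\<^sup>2"
    by (simp only: norm_mult complex_mod_cnj)
qed

lemma ell2_lincomb:
  assumes "x \<in> ell2 G" "y \<in> ell2 G"
  shows "(\<lambda>g. a * x g + b * y g) \<in> ell2 G"
proof -
  have "(\<lambda>g. (cmod (a * x g + b * y g))\<^sup>2) summable_on carrier G"
  proof (rule summable_on_comparison_test)
    show "(\<lambda>g. 2 * (cmod a)\<^sup>2 * (cmod (x g))\<^sup>2 + 2 * (cmod b)\<^sup>2 * (cmod (y g))\<^sup>2) summable_on carrier G"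
      using assms by (intro summable_on_add summable_on_cmult_right) (auto simp: ell2_def)
    fix g
    have "(cmod (a * x g + b * y g))\<^sup>2 \<le> (cmod (a * x g) + cmod (b * y g))\<^sup>2"
      by (intro power_mono norm_triangle_ineq) simp
    also have "\<dots> \<le> 2 * (cmod (a * x g))\<^sup>2 + 2 * (cmod (b * y g))\<^sup>2"
      using sum_squares_bound[of "cmod (a * x g)" "cmod (b * y g)"]
      by (simp add: power2_sum)
    finally show "(cmod (a * x g + b * y g))\<^sup>2
        \<le> 2 * (cmod a)\<^sup>2 * (cmod (x g))\<^sup>2 + 2 * (cmod b)\<^sup>2 * (cmod (y g))\<^sup>2"
      by (simp add: norm_mult power_mult_distrib)
  qed simp
  then show ?thesis using assms by (auto simp: ell2_def)
qed

lemma scalar_product_on_ell2: "scalar_product_on (ell2 G) (ell2_inner G)"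
  unfolding scalar_product_on_def
proof (intro conjI ballI allI impI)
  fix x y z a b assume "x \<in> ell2 G" "y \<in> ell2 G" "z \<in> ell2 G"
  note xz = ell2_inner_summable[OF this(1,3)] and yz = ell2_inner_summable[OF this(2,3)]
  have "(\<Sum>\<^sub>\<infinity>g\<in>carrier G. a * (x g * cnj (z g)) + b * (y g * cnj (z g)))
      = a * ell2_inner G x z + b * ell2_inner G y z"
    unfolding ell2_inner_def
    by (simp add: infsum_add infsum_cmult_right summable_on_cmult_right xz yz)
  then show "ell2_inner G (\<lambda>g. a * x g + b * y g) z = a * ell2_inner G x z + b * ell2_inner G y z"
    by (simp add: ell2_inner_def algebra_simps)
next
  fix x y :: "'a \<Rightarrow> complex"
  show "ell2_inner G y x = cnj (ell2_inner G x y)"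
    unfolding ell2_inner_def infsum_cnj[symmetric] by (simp add: mult.commute)
next
  fix x assume x: "x \<in> ell2 G" and nz: "x \<noteq> (\<lambda>g. 0)"
  have s: "(\<lambda>g. (cmod (x g))\<^sup>2) summable_on carrier G" using x by (simp add: ell2_def)
  have eq: "ell2_inner G x x = of_real (\<Sum>\<^sub>\<infinity>g\<in>carrier G. (cmod (x g))\<^sup>2)"
    unfolding ell2_inner_def complex_norm_square[symmetric]
    by (rule infsumI) (use s in \<open>intro has_sum_of_real has_sum_infsum\<close>)
  show "ell2_inner G x x \<in> \<real>" by (simp add: eq)
  obtain g where g: "g \<in> carrier G" "x g \<noteq> 0"
    using nz x by (auto simp: ell2_def fun_eq_iff)
  have "(\<Sum>\<^sub>\<infinity>g\<in>carrier G. (cmod (x g))\<^sup>2) \<noteq> 0"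
    using nonneg_infsum_le_0D[OF _ s _ g(1)] g(2) by fastforce
  moreover have "0 \<le> (\<Sum>\<^sub>\<infinity>g\<in>carrier G. (cmod (x g))\<^sup>2)" by (simp add: infsum_nonneg)
  ultimately show "0 < Re (ell2_inner G x x)" by (simp add: eq)
qed

lemma lin_span_subset_ell2:
  assumes "finite F" "F \<subseteq> carrier G"
  shows "lin_span F \<subseteq> ell2 G"
proof
  fix x assume "x \<in> lin_span F"
  then have x: "\<forall>g. g \<notin> F \<longrightarrow> x g = 0" by (simp add: lin_span_eq[OF assms(1)])
  have "(\<lambda>g. (cmod (x g))\<^sup>2) summable_on F \<longleftrightarrow> (\<lambda>g. (cmod (x g))\<^sup>2) summable_on carrier G"
    by (rule summable_on_cong_neutral) (use x assms in auto)
  then show "x \<in> ell2 G" using x assms by (auto simp: ell2_def)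
qed

lemma ell2_inner_basis_vec:
  assumes "\<gamma> \<in> carrier G"
  shows "ell2_inner G x (basis_vec \<gamma>) = x \<gamma>"
proof -
  have "ell2_inner G x (basis_vec \<gamma>) = (\<Sum>\<^sub>\<infinity>g\<in>{\<gamma>}. x g * cnj (basis_vec \<gamma> g))"
    unfolding ell2_inner_def
    by (rule infsum_cong_neutral) (use assms in \<open>auto simp: basis_vec_def\<close>)
  then show ?thesis by (simp add: basis_vec_def)
qed

lemma ell2_proj_eq:
  assumes "finite F" "F \<subseteq> carrier G"
  shows "ell2_proj G F x = (\<lambda>g. if g \<in> F then x g else 0)"
  unfolding ell2_proj_def
proof (rule the_equality)
  let ?y = "\<lambda>g. if g \<in> F then x g else 0"
  have "ell2_inner G (\<lambda>g. x g - ?y g) w = 0" if "w \<in> lin_span F" for w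
  proof -
    have "(x g - ?y g) * cnj (w g) = 0" for g
      using that by (auto simp: lin_span_eq[OF assms(1)])
    then show ?thesis unfolding ell2_inner_def by (intro infsum_0)
  qed
  then show "?y \<in> lin_span F \<and> (\<forall>w\<in>lin_span F. ell2_inner G (\<lambda>g. x g - ?y g) w = 0)"
    by (simp add: lin_span_eq[OF assms(1)])
next
  fix y
  assume y: "y \<in> lin_span F \<and> (\<forall>w\<in>lin_span F. ell2_inner G (\<lambda>g. x g - y g) w = 0)"
  have "y g = x g" if "g \<in> F" for g
  proof -
    have "basis_vec g \<in> lin_span F"
      using that by (auto simp: lin_span_eq[OF assms(1)] basis_vec_def)
    then have "ell2_inner G (\<lambda>g. x g - y g) (basis_vec g) = 0" using y by blast
    moreover have "g \<in> carrier G" using that assms by blast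
    ultimately show ?thesis using ell2_inner_basis_vec[of g G "\<lambda>g. x g - y g"] by simp
  qed
  then show "y = (\<lambda>g. if g \<in> F then x g else 0)"
    using y by (auto simp: lin_span_eq[OF assms(1)])
qed

lemma ell2_proj_is_orthogonal_projection:
  assumes "finite F" "F \<subseteq> carrier G"
  shows "is_orthogonal_projection (ell2_inner G) (ell2 G) (lin_span F) (ell2_proj G F)"
  unfolding is_orthogonal_projection_def
proof (intro conjI ballI)
  note S = lin_span_eq[OF assms(1)] and P = ell2_proj_eq[OF assms]
  show "scalar_product_on (ell2 G) (ell2_inner G)" by (rule scalar_product_on_ell2)
  show sub: "lin_span F \<subseteq> ell2 G" by (rule lin_span_subset_ell2[OF assms])
  show "linear_on (ell2 G) (ell2_proj G F)" by (auto simp: linear_on_def P)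
  show fixed: "ell2_proj G F w = w" if "w \<in> lin_span F" for w
    using that by (auto simp: P S)
  have "ell2_proj G F v \<in> lin_span F" for v by (simp add: P S)
  then show "ell2_proj G F ` ell2 G = lin_span F"
    using sub fixed by (auto simp: image_iff) (metis subsetD)
  fix v w assume "w \<in> lin_span F"
  then have "(v g - ell2_proj G F v g) * cnj (w g) = 0" for g by (auto simp: P S)
  then show "ell2_inner G (\<lambda>g. v g - ell2_proj G F v g) w = 0"
    unfolding ell2_inner_def by (intro infsum_0)
qed

end

theory Submission
  imports Defs
begin

text \<open>
  Over the complex numbers positivity of \<open>A\<close> makes \<open>(u, v)\<^sub>A = (Au, v)\<close> Hermitian by polarization.
  It is definite on \<open>\<complex>\<Gamma>\<close>: if \<open>(Au, u) = 0\<close>, then nonnegativity of \<open>(\<cdot>, \<cdot>)\<^sub>A\<close> at \<open>u - t Au\<close> for small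
  \<open>t > 0\<close> gives \<open>Au = 0\<close>, hence \<open>u = 0\<close> by injectivity. Definiteness makes the compression bijective,
  so that \<open>\<psi>v\<close> is the only \<open>u \<in> \<complex>F\<close> for which \<open>Au\<close> and \<open>Av\<close> agree on \<open>F\<close>, that is, for which
  \<open>v - u\<close> is orthogonal to \<open>\<complex>F\<close> with respect to \<open>(\<cdot>, \<cdot>)\<^sub>A\<close>.
\<close>

lemma ell2_inner_left_lincomb:
  assumes "x \<in> ell2 G" "y \<in> ell2 G" "z \<in> ell2 G"
  shows "ell2_inner G (\<lambda>g. a * x g + b * y g) z = a * ell2_inner G x z + b * ell2_inner G y z"
  using scalar_product_on_ell2[of G] assms unfolding scalar_product_on_def by blast

lemma ell2_inner_cnj:
  assumes "x \<in> ell2 G" "y \<in> ell2 G"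
  shows "ell2_inner G y x = cnj (ell2_inner G x y)"
  using scalar_product_on_ell2[of G] assms unfolding scalar_product_on_def by blast

lemma ell2_inner_right_lincomb:
  assumes "x \<in> ell2 G" "y \<in> ell2 G" "z \<in> ell2 G"
  shows "ell2_inner G z (\<lambda>g. a * x g + b * y g)
    = cnj a * ell2_inner G z x + cnj b * ell2_inner G z y"
  using assms ell2_lincomb[OF assms(1,2), of a b]
  by (simp add: ell2_inner_cnj[of _ G z] ell2_inner_left_lincomb)

lemma ell2_inner_self_pos:
  assumes "x \<in> ell2 G" "x \<noteq> (\<lambda>g. 0)"
  shows "ell2_inner G x x \<in> \<real>" "0 < Re (ell2_inner G x x)"
  using scalar_product_on_ell2[of G] assms unfolding scalar_product_on_def by blast+

lemma bounded_op_in_ell2: "bounded_op G A \<Longrightarrow> x \<in> ell2 G \<Longrightarrow> A x \<in> ell2 G"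
  unfolding bounded_op_def by blast

lemma bounded_op_lincomb:
  assumes "bounded_op G A" "x \<in> ell2 G" "y \<in> ell2 G"
  shows "A (\<lambda>g. a * x g + b * y g) = (\<lambda>g. a * A x g + b * A y g)"
  using assms unfolding bounded_op_def linear_on_def by blast

lemma bounded_op_zero:
  assumes "bounded_op G A"
  shows "A (\<lambda>g. 0) = (\<lambda>g. 0)"
proof -
  have "(\<lambda>g. 0) \<in> ell2 G" by (simp add: ell2_def)
  from bounded_op_lincomb[OF assms this this, of 0 0] show ?thesis by simp
qed

lemma bounded_op_form_lincomb:
  assumes "bounded_op G A" "x \<in> ell2 G" "y \<in> ell2 G"
  shows "ell2_inner G (A (\<lambda>g. a * x g + b * y g)) (\<lambda>g. a * x g + b * y g)
    = a * cnj a * ell2_inner G (A x) x + a * cnj b * ell2_inner G (A x) y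
      + (b * cnj a * ell2_inner G (A y) x + b * cnj b * ell2_inner G (A y) y)"
  using assms bounded_op_in_ell2[OF assms(1,2)] bounded_op_in_ell2[OF assms(1,3)]
  by (simp add: bounded_op_lincomb ell2_inner_left_lincomb ell2_inner_right_lincomb ell2_lincomb
      algebra_simps)

lemma positive_op_hermitian:
  assumes A: "bounded_op G A" and pos: "positive_op G A" and x: "x \<in> ell2 G" and y: "y \<in> ell2 G"
  shows "ell2_inner G (A y) x = cnj (ell2_inner G (A x) y)"
proof -
  have real: "Im (ell2_inner G (A z) z) = 0" if "z \<in> ell2 G" for z
    using pos that by (auto simp: positive_op_def complex_is_Real_iff)
  \<comment> \<open>The form is real at \<open>x + y\<close>, so the imaginary parts of its two
    cross terms cancel. At \<open>x + \<i> y\<close> the factor \<open>\<i>\<close> turns the same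
    condition into equality of their real parts.\<close>
  have "Im (ell2_inner G (A x) y + ell2_inner G (A y) x) = 0"
    using real[OF ell2_lincomb[OF x y, of 1 1]] bounded_op_form_lincomb[OF A x y, of 1 1]
      real[OF x] real[OF y] by simp
  moreover have "Re (ell2_inner G (A y) x - ell2_inner G (A x) y) = 0"
    using real[OF ell2_lincomb[OF x y, of 1 \<i>]] bounded_op_form_lincomb[OF A x y, of 1 \<i>]
      real[OF x] real[OF y] by simp
  ultimately show ?thesis by (simp add: complex_eq_iff)
qed

lemma positive_op_kernel:
  assumes A: "bounded_op G A" and pos: "positive_op G A" and x: "x \<in> ell2 G"
    and 0: "ell2_inner G (A x) x = 0"
  shows "A x = (\<lambda>g. 0)"
proof (rule ccontr)
  assume nz: "A x \<noteq> (\<lambda>g. 0)"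
  define N where "N = Re (ell2_inner G (A x) (A x))"
  define M where "M = Re (ell2_inner G (A (A x)) (A x))"
  \<comment> \<open>The form at \<open>x - t A x\<close> equals \<open>t * (t * M - 2 * N)\<close>,
    which is negative once \<open>t > 0\<close> and \<open>t * M < 2 * N\<close>. The summand 1
    keeps the quotient meaningful when \<open>M = 0\<close>.\<close>
  define t where "t = N / (M + 1)"
  note Ax = bounded_op_in_ell2[OF A x]
  have N: "0 < N" using ell2_inner_self_pos(2)[OF Ax nz] by (simp add: N_def)
  have M: "0 \<le> M" using pos Ax by (simp add: positive_op_def M_def)
  have t: "0 < t" using N M by (simp add: t_def)
  have "0 \<le> Re (ell2_inner G (A (\<lambda>g. 1 * x g + of_real (- t) * A x g))
      (\<lambda>g. 1 * x g + of_real (- t) * A x g))"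
    using pos ell2_lincomb[OF x Ax] unfolding positive_op_def by blast
  also have "\<dots> = t * (t * M - 2 * N)"
    unfolding bounded_op_form_lincomb[OF A x Ax] positive_op_hermitian[OF A pos x Ax]
    by (simp add: 0 N_def M_def algebra_simps)
  finally have "2 * N \<le> t * M" using t by (simp add: zero_le_mult_iff)
  moreover have "t * M < N" using N M by (simp add: t_def field_simps)
  ultimately show False using N by linarith
qed

lemma lin_span_lincomb:
  assumes "finite F" "x \<in> lin_span F" "y \<in> lin_span F"
  shows "(\<lambda>g. a * x g + b * y g) \<in> lin_span F"
  using assms by (simp add: lin_span_eq)

lemma lin_span_mono: "finite F' \<Longrightarrow> F \<subseteq> F' \<Longrightarrow> lin_span F \<subseteq> lin_span F'"
  using finite_subset[of F F'] by (auto simp: lin_span_eq)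

lemma ell2_inner_eq_0_if_vanishes_on:
  assumes "finite F" "w \<in> lin_span F" "\<And>g. g \<in> F \<Longrightarrow> x g = 0"
  shows "ell2_inner G x w = 0"
proof -
  have "x g * cnj (w g) = 0" for g
    using assms by (cases "g \<in> F") (auto simp: lin_span_eq)
  then show ?thesis unfolding ell2_inner_def by (intro infsum_0)
qed

text \<open>Definiteness on finite sums is what makes compressions invertible. The locale separates
  this linear algebra from the derivation of definiteness in
  \<open>definite_operatorI\<close>.\<close>

locale definite_operator =
  fixes G :: "('g, 'm) monoid_scheme"
    and A :: "('g \<Rightarrow> complex) \<Rightarrow> ('g \<Rightarrow> complex)"
  assumes bounded: "bounded_op G A"
    and definite: "x \<in> group_algebra G \<Longrightarrow> ell2_inner G (A x) x = 0 \<Longrightarrow> x = (\<lambda>g. 0)"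
begin

lemma in_lin_span:
  assumes "finite F" "F \<subseteq> carrier G" "x \<in> lin_span F"
  shows "x \<in> ell2 G" "x \<in> group_algebra G"
  using lin_span_subset_ell2[OF assms(1,2)] assms by (auto simp: group_algebra_def)

lemma lincomb_lin_span:
  assumes "finite F" "F \<subseteq> carrier G" "x \<in> lin_span F" "y \<in> lin_span F"
  shows "A (\<lambda>g. a * x g + b * y g) = (\<lambda>g. a * A x g + b * A y g)"
  using assms by (intro bounded_op_lincomb[OF bounded] in_lin_span)

text \<open>If \<open>A x\<close> vanishes on \<open>F\<close>, it is orthogonal to everything
  supported there, in particular to \<open>x\<close> itself, and definiteness applies. This is
  injectivity of the compression.\<close>

lemma eq_0_if_image_vanishes_on:
  assumes "finite F" "F \<subseteq> carrier G" "x \<in> lin_span F" "\<And>g. g \<in> F \<Longrightarrow> A x g = 0"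
  shows "x = (\<lambda>g. 0)"
  using assms by (intro definite in_lin_span ell2_inner_eq_0_if_vanishes_on)

lemma eq_if_images_agree_on:
  assumes F: "finite F" "F \<subseteq> carrier G" and xy: "x \<in> lin_span F" "y \<in> lin_span F"
    and eq: "\<And>g. g \<in> F \<Longrightarrow> A x g = A y g"
  shows "x = y"
proof -
  have "(\<lambda>g. 1 * x g + (-1) * y g) = (\<lambda>g. 0)"
    by (rule eq_0_if_image_vanishes_on[OF F lin_span_lincomb[OF F(1) xy]])
      (simp only: lincomb_lin_span[OF F xy], simp add: eq)
  then show ?thesis by (simp add: fun_eq_iff)
qed

text \<open>Gram--Schmidt: the induction hypothesis corrects \<open>basis_vec h\<close> by an element of \<open>\<complex>F\<close> to a
  vector \<open>w\<close> whose image vanishes on \<open>F\<close>. By definiteness this image does not vanish at \<open>h\<close>.\<close>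

lemma ex_prescribed_image:
  assumes "finite F" "F \<subseteq> carrier G"
  shows "\<exists>u\<in>lin_span F. \<forall>g\<in>F. A u g = v g"
  using assms
\<comment> \<open>The target \<open>v\<close> is generalised because the induction hypothesis is
  applied both to it and to \<open>A (basis_vec h)\<close>.\<close>
proof (induction F arbitrary: v rule: finite_induct)
  case empty
  then show ?case by (auto simp: lin_span_eq)
next
  case (insert h F)
  let ?F = "insert h F"
  have fin: "finite ?F" and F: "?F \<subseteq> carrier G" "F \<subseteq> carrier G" using insert by auto
  have sub: "lin_span F \<subseteq> lin_span ?F" using fin by (intro lin_span_mono) auto
  obtain r where r: "r \<in> lin_span F" "\<forall>g\<in>F. A r g = A (basis_vec h) g"
    using insert.IH[OF F(2)] by blast
  obtain u where u: "u \<in> lin_span F" "\<forall>g\<in>F. A u g = v g"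
    using insert.IH[OF F(2)] by blast
  have h: "basis_vec h \<in> lin_span ?F" using fin by (simp add: lin_span_eq basis_vec_def)
  have r': "r \<in> lin_span ?F" and u': "u \<in> lin_span ?F" using r(1) u(1) sub by auto
  define w where "w = (\<lambda>g. 1 * basis_vec h g + (-1) * r g)"
  have w: "w \<in> lin_span ?F" unfolding w_def by (rule lin_span_lincomb[OF fin h r'])
  have Aw: "A w g = 0" if "g \<in> F" for g
    using that r(2) unfolding w_def lincomb_lin_span[OF fin F(1) h r'] by simp
  \<comment> \<open>The correction \<open>r\<close> is supported on \<open>F\<close>, which does not
    contain \<open>h\<close>, so \<open>w\<close> cannot be zero.\<close>
  have "w h = 1" using r(1) insert.hyps by (simp add: w_def basis_vec_def lin_span_eq)
  then have Awh: "A w h \<noteq> 0"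
    using eq_0_if_image_vanishes_on[OF fin F(1) w] Aw by fastforce
  \<comment> \<open>Adding \<open>t * w\<close> to \<open>u\<close> repairs the value at
    \<open>h\<close> and leaves those on \<open>F\<close> unchanged, since \<open>A w\<close>
    vanishes there.\<close>
  define t where "t = (v h - A u h) / A w h"
  let ?u = "\<lambda>g. 1 * u g + t * w g"
  have "?u \<in> lin_span ?F" by (rule lin_span_lincomb[OF fin u' w])
  moreover have "A ?u g = v g" if "g \<in> ?F" for g
    unfolding lincomb_lin_span[OF fin F(1) u' w]
    using that u(2) Aw Awh by (auto simp: t_def)
  ultimately show ?case by blast
qed

context
  fixes F :: "'g set"
  assumes F: "finite F" "F \<subseteq> carrier G"
begin

text \<open>\<open>inv_into\<close> is meaningful only on the range of the compression;
  \<open>ex_prescribed_image\<close> puts the projection of \<open>A v\<close> into that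
  range.\<close>

lemma compression_inv:
  defines "P \<equiv> \<lambda>v. inv_into (lin_span F) (compression G A F) (ell2_proj G F (A v))"
  shows "P v \<in> lin_span F" "g \<in> F \<Longrightarrow> A (P v) g = A v g"
proof -
  obtain u where u: "u \<in> lin_span F" "\<forall>g\<in>F. A u g = A v g"
    using ex_prescribed_image[OF F, of "A v"] by blast
  have "ell2_proj G F (A v) = compression G A F u"
    using u(2) by (auto simp: compression_def ell2_proj_eq[OF F])
  then have "ell2_proj G F (A v) \<in> compression G A F ` lin_span F"
    using u(1) by (rule image_eqI)
  then have "P v \<in> lin_span F" "compression G A F (P v) = ell2_proj G F (A v)"
    unfolding P_def by (rule inv_into_into, rule f_inv_into_f)
  then show "P v \<in> lin_span F" "g \<in> F \<Longrightarrow> A (P v) g = A v g"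
    by (auto simp: compression_def ell2_proj_eq[OF F] fun_eq_iff split: if_splits)
qed

text \<open>Injectivity makes agreement of images on \<open>F\<close> determine the value of \<psi>.
  Linearity of \<psi> and its fixing of \<open>lin_span F\<close> thus become comparisons on
  \<open>F\<close>.\<close>

lemma compression_inv_eqI:
  assumes "u \<in> lin_span F" "\<And>g. g \<in> F \<Longrightarrow> A u g = A v g"
  shows "inv_into (lin_span F) (compression G A F) (ell2_proj G F (A v)) = u"
  using assms compression_inv by (intro eq_if_images_agree_on[OF F]) auto

end

end

lemma definite_operatorI:
  assumes A: "bounded_op G A" and pos: "positive_op G A" and inj: "inj_on A (group_algebra G)"
  shows "definite_operator G A"
proof
  show "bounded_op G A" by (rule A)
  fix x assume x: "x \<in> group_algebra G" and 0: "ell2_inner G (A x) x = 0"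
  have "x \<in> ell2 G" using x lin_span_subset_ell2 by (fastforce simp: group_algebra_def)
  then have "A x = A (\<lambda>g. 0)" using positive_op_kernel[OF A pos _ 0] bounded_op_zero[OF A] by simp
  moreover have "(\<lambda>g. 0) \<in> group_algebra G"
    by (auto simp: group_algebra_def lin_span_eq intro!: exI[of _ "{}"])
  ultimately show "x = (\<lambda>g. 0)" using inj x by (auto dest: inj_onD)
qed

theorem proposition9:
  fixes G :: "('g, 'm) monoid_scheme"
    and F F' :: "'g set"
    and A :: "('g \<Rightarrow> complex) \<Rightarrow> ('g \<Rightarrow> complex)"
  assumes "group G" and "countable (carrier G)"
    and "finite F'" and "F \<subseteq> F'" and "F' \<subseteq> carrier G"
    and "A \<in> group_vN_algebra G"
    and "positive_op G A"
    and "inj_on A (group_algebra G)"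
  shows "is_orthogonal_projection (\<lambda>u v. ell2_inner G (A u) v) (lin_span F') (lin_span F)
           (\<lambda>v. inv_into (lin_span F) (compression G A F) (ell2_proj G F (A v)))"
proof -
  have A: "bounded_op G A" using assms(6) by (simp add: group_vN_algebra_def)
  interpret definite_operator G A by (rule definite_operatorI[OF A assms(7,8)])
  note F' = assms(3,5)
  have F: "finite F" "F \<subseteq> carrier G" using assms finite_subset by auto
  note ell2 = in_lin_span(1)[OF F']
  note sub = lin_span_mono[OF assms(3,4)]
  note P = compression_inv[OF F]
  let ?P = "\<lambda>v. inv_into (lin_span F) (compression G A F) (ell2_proj G F (A v))"
  show ?thesis
    unfolding is_orthogonal_projection_def
  proof (intro conjI ballI)
    show "scalar_product_on (lin_span F') (\<lambda>u v. ell2_inner G (A u) v)"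
      unfolding scalar_product_on_def
    proof (intro conjI ballI allI impI)
      fix x y z a b assume xyz: "x \<in> lin_span F'" "y \<in> lin_span F'" "z \<in> lin_span F'"
      then show "ell2_inner G (A (\<lambda>g. a * x g + b * y g)) z
          = a * ell2_inner G (A x) z + b * ell2_inner G (A y) z"
        by (simp add: lincomb_lin_span[OF F'] ell2_inner_left_lincomb bounded_op_in_ell2[OF A] ell2)
    next
      fix x y assume "x \<in> lin_span F'" "y \<in> lin_span F'"
      then show "ell2_inner G (A y) x = cnj (ell2_inner G (A x) y)"
        by (intro positive_op_hermitian[OF A assms(7)] ell2)
    next
      fix x assume x: "x \<in> lin_span F'" and nz: "x \<noteq> (\<lambda>g. 0)"
      have real: "ell2_inner G (A x) x \<in> \<real>" and ge: "0 \<le> Re (ell2_inner G (A x) x)"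
        using assms(7) ell2[OF x] by (auto simp: positive_op_def)
      show "ell2_inner G (A x) x \<in> \<real>" by (rule real)
      have "ell2_inner G (A x) x \<noteq> 0" using definite[OF in_lin_span(2)[OF F' x]] nz by blast
      then show "0 < Re (ell2_inner G (A x) x)"
        using real ge by (auto simp: complex_is_Real_iff complex_eq_iff)
    qed
  next
    show "lin_span F \<subseteq> lin_span F'" by (rule sub)
  next
    show "linear_on (lin_span F') ?P"
      unfolding linear_on_def
    proof (intro ballI allI)
      fix x y a b assume xy: "x \<in> lin_span F'" "y \<in> lin_span F'"
      show "?P (\<lambda>g. a * x g + b * y g) = (\<lambda>g. a * ?P x g + b * ?P y g)"
        \<comment> \<open>The right-hand side lies in \<open>lin_span F\<close>, and on
          \<open>F\<close> its image is the same combination of \<open>A x\<close> and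
          \<open>A y\<close>.\<close>
        using lin_span_lincomb[OF F(1) P(1) P(1)]
        by (rule compression_inv_eqI[OF F])
          (simp add: lincomb_lin_span[OF F P(1) P(1)] lincomb_lin_span[OF F' xy] P(2))
    qed
  next
    show fixed: "?P w = w" if "w \<in> lin_span F" for w
      using that by (intro compression_inv_eqI[OF F]) auto
    then show "?P ` lin_span F' = lin_span F"
      using sub P(1) by (auto simp: image_iff) (metis subsetD)
  next
    fix v w assume v: "v \<in> lin_span F'" and w: "w \<in> lin_span F"
    have Pv: "?P v \<in> lin_span F'" using P(1) sub by blast
    \<comment> \<open>Orthogonality to \<open>lin_span F\<close> for the new scalar product means
      that the image of \<open>v - ?P v\<close> vanishes on \<open>F\<close>.\<close>
    have "A (\<lambda>g. 1 * v g + (-1) * ?P v g) g = 0" if "g \<in> F" for g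
      unfolding lincomb_lin_span[OF F' v Pv] using that by (simp add: P(2))
    then show "ell2_inner G (A (\<lambda>g. v g - ?P v g)) w = 0"
      by (intro ell2_inner_eq_0_if_vanishes_on[OF F(1) w]) simp
  qed
qed

end
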